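(* Let $u(x,t)$ be a non-negative solution of the initial boundary value problem (P) described in the context. Assume $\alpha_0>0$ satisfies $\alpha_0\ge 2-\delta$ and $\alpha_0>\alpha_*$. Let $B_R$, with $R>0$, be a ball in a compact subset of $U$, and let $T>0$, $\sigma\in(0,1)$. Then $$\|u\|_{L^\infty(B_{R/2}\times(\sigma T,T))}\le\widehat{\mathcal C}_{R,T,\sigma}\max\Big\{\|u\|^{\mu}_{L^{\alpha_0}(B_R\times(0,T))},\ \|u\|^{\nu}_{L^{\alpha_0}(B_R\times(0,T))}\Big\},$$ where $B_{R/2}$ is the ball of radius $R/2$ concentric with $B_R$, $$\mu=\prod_{j=0}^\infty\frac{\alpha_0\kappa_*^j-2+\delta}{\alpha_0\kappa_*^j},\qquad \nu=\prod_{j=0}^\infty\frac{\alpha_0\kappa_*^j}{\alpha_0\kappa_*^j+\delta-a},$$ $$\widehat{\mathcal C}_{R,T,\sigma}=\Big[2^{11}c_{10}\,\alpha_0^{6-a}(1+R^{-1})^2(1+|B_R|T)^3\Big(1+\frac1{\sigma T}+\frac1{R^{2-a}}\Big)^2\Big]^{\omega},$$ with $\kappa_*=\kappa(\alpha_0)$, where $\kappa(\alpha)=1+\frac{2-a}{n}-\frac{a-\delta}{\alpha}$, the constant $c_{10}$ is as in the context, and $\omega$ is some positive number depending on $\alpha_0$.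
   Context: Setting. $n\ge2$ is an integer; $U\subset\mathbb R^n$ is open and bounded with $C^1$ boundary $\Gamma=\partial U$ and outward normal $\vec\nu$. Fix an integer $N\ge1$, reals $0=\gamma_0<\gamma_1<\dots<\gamma_N$ and $a_0,\dots,a_N>0$, and set $g(s)=\sum_{i=0}^N a_is^{\gamma_i}$ for $s\ge0$. For $\xi\ge0$, $K(\xi)=1/g(s(\xi))$, where $s(\xi)$ is the unique non-negative solution $s$ of $s\,g(s)=\xi$. Put $a=\gamma_N/(\gamma_N+1)\in(0,1)$. Fix $\lambda\in(0,1]$ and set $\delta=1-\lambda$, $\alpha_*=n(a-\delta)/(2-a)$. Standing assumption: $a>\delta$. Problem (P): $\partial_t(u^\lambda)=\nabla\cdot(K(|\nabla u|)\nabla u)$ in $U\times(0,\infty)$; $u(x,0)=u_0(x)$ in $U$; $K(|\nabla u|)\frac{\partial u}{\partial\vec\nu}+\varphi u^\lambda=0$ on $\Gamma\times(0,\infty)$, where $u_0(x)$ and $\varphi(x,t)$ are given. Solutions are understood to be regular enough that the quantities involved make sense and that the equation may be multiplied by powers of $u$ times smooth cut-off functions and integrated by parts. Constant $c_{10}$: $c_{10}\ge1$ is a constant (depending only on $\lambda,g,n$; independent of $U$, $\alpha$, $\rho$, $R$, $T_1$, $T_2$, $T$) such that for all $\alpha$ with $\alpha\ge2-\delta$, $\alpha>\alpha_*$, all concentric balls $B_\rho,B_R$ ($R>\rho>0$) in a compact subset of $U$, all $T>T_2>T_1\ge0$ and every non-negative solution $u$ of (P), $$\|u\|_{L^{\kappa(\alpha)\alpha}(B_\rho\times(T_2,T))}\le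 A_\alpha^{1/\alpha}\Big(\|u\|_{L^\alpha(B_R\times(T_1,T))}^{\alpha+\delta-2}+\|u\|_{L^\alpha(B_R\times(T_1,T))}^{\alpha^2/(\alpha+\delta-a)}\Big)^{1/\alpha},$$ with $A_\alpha=c_{10}(1+\rho^{-1})^{2-a}\alpha^{6-a}(1+|B_R|T)^2\big(1+\frac1{T_2-T_1}+\frac1{(R-\rho)^{2-a}}\big)^2$. *)

theory Defs
  imports "HOL-Analysis.Analysis" "HOL-Probability.Essential_Supremum"
begin

text \<open>Real powers with the convention \<open>x\<^sup>0 = 1\<close> for every \<open>x\<close>, including \<open>x = 0\<close>; the library has
  \<open>0 powr 0 = 0\<close>. The two agree for a nonzero exponent.\<close>

definition rpow :: "real \<Rightarrow> real \<Rightarrow> real" where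
  "rpow x p = (if p = 0 then 1 else x powr p)"

definition g_fun :: "nat \<Rightarrow> (nat \<Rightarrow> real) \<Rightarrow> (nat \<Rightarrow> real) \<Rightarrow> real \<Rightarrow> real" where
  "g_fun N c \<gamma> s = (\<Sum>i\<le>N. c i * rpow s (\<gamma> i))"

definition s_of :: "(real \<Rightarrow> real) \<Rightarrow> real \<Rightarrow> real" where
  "s_of g \<xi> = (THE s. 0 \<le> s \<and> s * g s = \<xi>)"

definition K_fun :: "(real \<Rightarrow> real) \<Rightarrow> real \<Rightarrow> real" where
  "K_fun g \<xi> = 1 / g (s_of g \<xi>)"

text \<open>On the open neighbourhood \<open>V\<close> of \<open>x\<close>, \<open>h\<close> is a \<open>C\<^sup>1\<close> function with nowhere vanishing gradient
  \<open>h'\<close>, and \<open>U\<close> is the set where \<open>h\<close> is negative. Then \<open>frontier U \<inter> V\<close> is the zero set of \<open>h\<close> in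
  \<open>V\<close>, and \<open>h'\<close> points out of \<open>U\<close> there.\<close>

definition defining_function ::
  "(real^'n) set \<Rightarrow> real^'n \<Rightarrow> (real^'n) set \<Rightarrow> (real^'n \<Rightarrow> real) \<Rightarrow> (real^'n \<Rightarrow> real^'n) \<Rightarrow> bool" where
  "defining_function U x V h h' \<longleftrightarrow>
     open V \<and> x \<in> V \<and>
     (\<forall>y\<in>V. GDERIV h y :> h' y \<and> h' y \<noteq> 0) \<and>
     continuous_on V h' \<and>
     U \<inter> V = {y \<in> V. h y < 0}"

definition bounded_C1_domain :: "(real^'n) set \<Rightarrow> bool" where
  "bounded_C1_domain U \<longleftrightarrow>
     open U \<and> bounded U \<and> (\<forall>x\<in>frontier U. \<exists>V h h'. defining_function U x V h h')"

definition outward_normal :: "(real^'n) set \<Rightarrow> real^'n \<Rightarrow> real^'n \<Rightarrow> bool" where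
  "outward_normal U x v \<longleftrightarrow> (\<exists>V h h'. defining_function U x V h h' \<and> v = h' x /\<^sub>R norm (h' x))"

definition has_divergence :: "(real^'n \<Rightarrow> real^'n) \<Rightarrow> real \<Rightarrow> real^'n \<Rightarrow> bool" where
  "has_divergence F d x \<longleftrightarrow>
     (\<exists>F'. (F has_derivative F') (at x) \<and> d = (\<Sum>i\<in>UNIV. F' (axis i 1) $ i))"

text \<open>Solutions of the initial boundary value problem, in the classical sense: \<open>G\<close> is the spatial
  gradient of \<open>u\<close>, extended continuously up to the lateral boundary, and \<open>D\<close> is the common value of
  the two sides of the equation. The continuity conditions make \<open>u\<close> locally bounded and allow the
  equation to be multiplied by powers of \<open>u\<close> times cut-off functions and integrated by parts.\<close>

definition solution_P ::
  "(real \<Rightarrow> real) \<Rightarrow> real \<Rightarrow> (real^'n) set \<Rightarrow> (real^'n \<Rightarrow> real) \<Rightarrow> (real^'n \<Rightarrow> real \<Rightarrow> real) \<Rightarrow>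
   ((real^'n) \<times> real \<Rightarrow> real) \<Rightarrow> bool" where
  "solution_P K lam U u0 \<phi> u \<longleftrightarrow>
     continuous_on (closure U \<times> {0..}) u \<and>
     (\<forall>x\<in>U. u (x, 0) = u0 x) \<and>
     (\<exists>G D. continuous_on (closure U \<times> {0<..}) G \<and>
        continuous_on (U \<times> {0<..}) D \<and>
        (\<forall>x\<in>U. \<forall>t>0.
           GDERIV (\<lambda>y. u (y, t)) x :> G (x, t) \<and>
           ((\<lambda>\<tau>. u (x, \<tau>) powr lam) has_real_derivative D (x, t)) (at t) \<and>
           has_divergence (\<lambda>y. K (norm (G (y, t))) *\<^sub>R G (y, t)) (D (x, t)) x) \<and>
        (\<forall>x\<in>frontier U. \<forall>t>0. \<forall>v. outward_normal U x v \<longrightarrow>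
           K (norm (G (x, t))) * (G (x, t) \<bullet> v) + \<phi> x t * u (x, t) powr lam = 0))"

definition nonneg_solution_P ::
  "(real \<Rightarrow> real) \<Rightarrow> real \<Rightarrow> (real^'n) set \<Rightarrow> (real^'n \<Rightarrow> real) \<Rightarrow> (real^'n \<Rightarrow> real \<Rightarrow> real) \<Rightarrow>
   ((real^'n) \<times> real \<Rightarrow> real) \<Rightarrow> bool" where
  "nonneg_solution_P K lam U u0 \<phi> u \<longleftrightarrow>
     solution_P K lam U u0 \<phi> u \<and> (\<forall>x\<in>closure U. \<forall>t\<ge>0. 0 \<le> u (x, t))"

text \<open>The \<open>L\<^sup>p\<close> norm is only used for functions in \<open>L\<^sup>p(A)\<close>: a solution is continuous on
  \<open>closure U \<times> {0..}\<close>, hence bounded on the bounded cylinders considered.\<close>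

definition Lp_norm :: "real \<Rightarrow> 'a::euclidean_space set \<Rightarrow> ('a \<Rightarrow> real) \<Rightarrow> real" where
  "Lp_norm p A f = (set_lebesgue_integral lborel A (\<lambda>z. \<bar>f z\<bar> powr p)) powr (1 / p)"

definition Linf_norm :: "'a::euclidean_space set \<Rightarrow> ('a \<Rightarrow> real) \<Rightarrow> ereal" where
  "Linf_norm A f = esssup (restrict_space lborel A) (\<lambda>z. ereal \<bar>f z\<bar>)"

definition in_compact_subset :: "'a::metric_space set \<Rightarrow> 'a set \<Rightarrow> bool" where
  "in_compact_subset B U \<longleftrightarrow> (\<exists>C. compact C \<and> B \<subseteq> C \<and> C \<subseteq> U)"

text \<open>In the following definitions \<open>n\<close> is the space dimension, \<open>a\<close> the degeneracy exponent
  \<open>\<gamma>\<^sub>N / (\<gamma>\<^sub>N + 1)\<close> and \<open>\<delta> = 1 - \<lambda>\<close>.\<close>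

definition alpha_star :: "nat \<Rightarrow> real \<Rightarrow> real \<Rightarrow> real" where
  "alpha_star n a \<delta> = real n * (a - \<delta>) / (2 - a)"

definition kappa :: "nat \<Rightarrow> real \<Rightarrow> real \<Rightarrow> real \<Rightarrow> real" where
  "kappa n a \<delta> \<alpha> = 1 + (2 - a) / real n - (a - \<delta>) / \<alpha>"

text \<open>The constant \<open>A\<^sub>\<alpha>\<close>; the argument \<open>vol\<close> stands for the volume of the ball of radius \<open>R\<close>.\<close>

definition A_const ::
  "real \<Rightarrow> real \<Rightarrow> real \<Rightarrow> real \<Rightarrow> real \<Rightarrow> real \<Rightarrow> real \<Rightarrow> real \<Rightarrow> real \<Rightarrow> real" where
  "A_const c10 a \<alpha> vol \<rho> R T1 T2 T =
     c10 * (1 + 1 / \<rho>) powr (2 - a) * \<alpha> powr (6 - a) * (1 + vol * T)^2 *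
     (1 + 1 / (T2 - T1) + 1 / (R - \<rho>) powr (2 - a))^2"

definition mu_exp :: "real \<Rightarrow> real \<Rightarrow> real \<Rightarrow> real" where
  "mu_exp \<delta> \<alpha>0 \<kappa>s = (\<Prod>j. (\<alpha>0 * \<kappa>s ^ j - 2 + \<delta>) / (\<alpha>0 * \<kappa>s ^ j))"

definition nu_exp :: "real \<Rightarrow> real \<Rightarrow> real \<Rightarrow> real \<Rightarrow> real" where
  "nu_exp a \<delta> \<alpha>0 \<kappa>s = (\<Prod>j. \<alpha>0 * \<kappa>s ^ j / (\<alpha>0 * \<kappa>s ^ j + \<delta> - a))"

definition C_hat :: "real \<Rightarrow> real \<Rightarrow> real \<Rightarrow> real \<Rightarrow> real \<Rightarrow> real \<Rightarrow> real \<Rightarrow> real \<Rightarrow> real" where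
  "C_hat c10 a \<alpha>0 \<omega> vol R T \<sigma> =
     (2^11 * c10 * \<alpha>0 powr (6 - a) * (1 + 1 / R)^2 * (1 + vol * T)^3 *
      (1 + 1 / (\<sigma> * T) + 1 / R powr (2 - a))^2) powr \<omega>"

end

theory Submission
  imports Defs
begin

text \<open>The proof is Moser's iteration. The assumed estimate improves the integrability of a solution from
  the exponent \<open>\<alpha>\<close> to \<open>\<kappa>(\<alpha>) \<alpha>\<close> at the price of a smaller cylinder. The condition \<open>\<alpha>0 > \<alpha>\<^sub>*\<close> says exactly that
  \<open>\<kappa>\<^sub>* = \<kappa>(\<alpha>0) > 1\<close>, and \<open>\<kappa>\<close> increases with \<open>\<alpha>\<close>. The estimate can therefore be applied along the exponents
  \<open>\<alpha>\<^sub>j = \<alpha>0 \<kappa>\<^sub>*\<^sup>j\<close> and along the cylinders \<open>Q\<^sub>j\<close> with radius \<open>R / 2 (1 + 2\<^bsup>-j\<^esup>)\<close> and initial time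
  \<open>\<sigma> T (1 - 2\<^bsup>-j\<^esup>)\<close>, which shrink from \<open>B\<^sub>R \<times> (0, T)\<close> to the cylinder of the conclusion. The exponents tend to
  infinity, and the limit of the bounds on the norms is a bound on the essential supremum
  (\<open>Linf_norm_le_of_Lp_norm_le\<close>).

  Since \<open>\<kappa>(\<alpha>\<^sub>j) \<alpha>\<^sub>j\<close> may exceed \<open>\<alpha>\<^bsub>j+1\<^esub>\<close>, each step also uses the inclusion between \<open>L\<^sup>p\<close> spaces on a set of
  finite measure (\<open>Lp_norm_le_measure_times_Lp_norm\<close>). This contributes one more factor
  \<open>1 + |B\<^sub>R| T\<close> and explains its third power in the final constant.

  Let \<open>Y\<^sub>j\<close> be the norm of \<open>u\<close> on \<open>Q\<^sub>j\<close> with exponent \<open>\<alpha>\<^sub>j\<close>, let \<open>\<mu>\<^sub>j \<le> 1 \<le> \<nu>\<^sub>j\<close> be the factors of the products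
  defining \<open>\<mu>\<close> and \<open>\<nu>\<close>, and let \<open>E\<close> be the bracket in the final constant. Halving the gaps at each step and
  letting \<open>\<alpha>\<^sub>j\<close> grow multiplies the constants by \<open>16 \<kappa>\<^sub>*\<^bsup>6-a\<^esup>\<close> per step (\<open>A_const_dyadic_bound\<close>), which
  is at most a fixed power \<open>E\<^sup>d\<close> because \<open>E \<ge> 2\<^bsup>11\<^esup>\<close>. One step then reads
  \<open>Y\<^bsub>j+1\<^esub> \<le> E\<^bsup>b(j)\<^esup> max (Y\<^sub>j\<^bsup>\<mu>(j)\<^esup>) (Y\<^sub>j\<^bsup>\<nu>(j)\<^esup>)\<close> with \<open>b\<^sub>j = (1 + d j) / \<alpha>\<^sub>j\<close>. Iterating, the exponents of the norm
  multiply up to \<open>\<mu>\<close> and \<open>\<nu>\<close>, and the exponent of \<open>E\<close> stays below \<open>\<omega> = \<nu> (b\<^sub>0 + b\<^sub>1 + \<dots>)\<close>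
  (\<open>max_power_iteration_limit\<close>). Everything converges because \<open>\<alpha>\<^sub>j\<close> grows geometrically.\<close>

section \<open>Powers with the convention that the zeroth power is one\<close>

lemma rpow_nonneg: "0 \<le> rpow x p"
  by (simp add: rpow_def)

lemma rpow_eq_powr: "0 < x \<Longrightarrow> rpow x p = x powr p"
  by (simp add: rpow_def)

lemma rpow_mono: "0 \<le> x \<Longrightarrow> x \<le> y \<Longrightarrow> 0 \<le> p \<Longrightarrow> rpow x p \<le> rpow y p"
  by (simp add: rpow_def powr_mono2)

lemma rpow_mult: "0 \<le> x \<Longrightarrow> 0 \<le> y \<Longrightarrow> rpow (x * y) p = rpow x p * rpow y p"
  by (simp add: rpow_def powr_mult)

lemma rpow_rpow: "rpow (rpow x p) q = rpow x (p * q)"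
  by (auto simp: rpow_def powr_powr)

lemma rpow_max: "0 \<le> x \<Longrightarrow> 0 \<le> y \<Longrightarrow> 0 \<le> p \<Longrightarrow> rpow (max x y) p = max (rpow x p) (rpow y p)"
  using rpow_mono[of x y p] rpow_mono[of y x p] by (auto simp: max_def)

text \<open>In its exponent a power is monotone, increasing for \<open>x \<ge> 1\<close> and decreasing for \<open>0 < x < 1\<close>, so that an
  intermediate exponent never gives more than both extreme ones. At \<open>x = 0\<close> the only nonzero power is
  the zeroth, and \<open>q = 0\<close> forces \<open>p = 0\<close>.\<close>

lemma rpow_between:
  assumes "0 \<le> x" "0 \<le> p" "p \<le> q" "q \<le> r"
  shows "rpow x q \<le> max (rpow x p) (rpow x r)"
proof -
  consider "x = 0" | "0 < x" "x < 1" | "1 \<le> x" using assms by linarith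
  then show ?thesis
  proof cases
    case 1
    then show ?thesis using assms by (auto simp: rpow_def)
  next
    case 2
    then have "rpow x q \<le> rpow x p"
      using assms by (simp add: rpow_eq_powr powr_mono')
    then show ?thesis by simp
  next
    case 3
    then have "rpow x q \<le> rpow x r"
      using assms by (simp add: rpow_eq_powr powr_mono)
    then show ?thesis by simp
  qed
qed

text \<open>At \<open>x = 0\<close> the power jumps when the exponent reaches zero, so convergence of the exponents is not
  enough. The exponents here are partial products of a convergent infinite product, whose value is
  zero only if some factor is, and then the partial products are zero from that factor on. This
  covers the endpoint \<open>\<alpha>0 = 2 - \<delta>\<close>, where the exponent \<open>\<mu>\<close> of the theorem vanishes.\<close>

lemma tendsto_rpow_prodinf:
  fixes f :: "nat \<Rightarrow> real"
  assumes "0 \<le> x" and conv: "convergent_prod f"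
  shows "(\<lambda>n. rpow x (\<Prod>i<n. f i)) \<longlonglongrightarrow> rpow x (prodinf f)"
proof -
  have lim: "(\<lambda>n. \<Prod>i<n. f i) \<longlonglongrightarrow> prodinf f"
    using convergent_prod_LIMSEQ[OF conv] filterlim_sequentially_Suc[of "\<lambda>n. \<Prod>i<n. f i"]
    by (simp add: lessThan_Suc_atMost)
  show ?thesis
  proof (cases "x = 0")
    case False
    then show ?thesis using \<open>0 \<le> x\<close> lim by (simp add: rpow_eq_powr tendsto_powr)
  next
    case True
    have "\<forall>\<^sub>F n in sequentially. (\<Prod>i<n. f i) = 0 \<longleftrightarrow> prodinf f = 0"
    proof (cases "prodinf f = 0")
      case True
      then obtain i where "f i = 0" using prodinf_nonzero[OF conv] by blast
      then have "(\<Prod>i<n. f i) = 0" if "n > i" for n using that by (auto simp: prod_zero_iff)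
      with True show ?thesis by (intro eventually_mono[OF eventually_gt_at_top[of i]]) blast
    next
      case False
      then have "\<forall>\<^sub>F n in sequentially. (\<Prod>i<n. f i) \<noteq> 0"
        using tendsto_imp_eventually_ne[OF lim] by blast
      then show ?thesis using False by (auto elim: eventually_mono)
    qed
    then have "\<forall>\<^sub>F n in sequentially. rpow x (\<Prod>i<n. f i) = rpow x (prodinf f)"
      by eventually_elim (use True in \<open>auto simp: rpow_def\<close>)
    then show ?thesis by (rule tendsto_eventually)
  qed
qed

section \<open>The numerical iteration\<close>

text \<open>Raising the larger of \<open>y\<^sup>p\<close> and \<open>y\<^sup>q\<close> to the powers \<open>m\<close> and \<open>n\<close> also produces the mixed exponents
  \<open>p n\<close> and \<open>q m\<close>. Both lie between \<open>p m\<close> and \<open>q n\<close>, so the shape of the bound, a maximum over two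
  exponents, survives the step. No distinction between \<open>y \<ge> 1\<close> and \<open>y < 1\<close> has to be carried along.\<close>

lemma max_rpow_step:
  assumes y: "0 \<le> y" and E: "1 \<le> E" and w: "0 \<le> w" and pq: "0 \<le> p" "p \<le> q"
    and mn: "0 \<le> m" "m \<le> 1" "1 \<le> n" and Y: "0 \<le> Y"
    and le: "Y \<le> E powr w * max (rpow y p) (rpow y q)"
  shows "max (rpow Y m) (rpow Y n) \<le> E powr (w * n) * max (rpow y (p * m)) (rpow y (q * n))"
proof -
  let ?Z = "E powr w * max (rpow y p) (rpow y q)"
  have ex: "p * m \<le> q * m" "q * m \<le> q * n" "p * m \<le> p * n" "p * n \<le> q * n" "0 \<le> p * m"
    using pq mn by (auto intro: mult_right_mono mult_left_mono)
  have bound: "rpow Y e \<le> E powr (w * n) * max (rpow y (p * m)) (rpow y (q * n))"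
    if e: "0 \<le> e" "m \<le> e" "e \<le> n" for e
  proof -
    have me: "p * m \<le> p * e" "p * e \<le> q * e" "q * e \<le> q * n"
      using pq e by (auto intro: mult_right_mono mult_left_mono)
    have "rpow Y e \<le> rpow ?Z e" using Y le e by (intro rpow_mono)
    also have "\<dots> = E powr (w * e) * max (rpow y (p * e)) (rpow y (q * e))"
      using E e by (simp add: rpow_mult rpow_max rpow_nonneg rpow_rpow rpow_eq_powr powr_powr le_max_iff_disj)
    also have "\<dots> \<le> E powr (w * n) * max (rpow y (p * m)) (rpow y (q * n))"
    proof (rule mult_mono)
      show "E powr (w * e) \<le> E powr (w * n)"
        using E w e by (intro powr_mono mult_left_mono)
      show "max (rpow y (p * e)) (rpow y (q * e)) \<le> max (rpow y (p * m)) (rpow y (q * n))"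
        using rpow_between[OF y ex(5), of "p * e" "q * n"] rpow_between[OF y ex(5), of "q * e" "q * n"] me
        by (intro max.boundedI) auto
    qed (auto simp: le_max_iff_disj rpow_nonneg)
    finally show ?thesis .
  qed
  show ?thesis using bound[of m] bound[of n] mn by (intro max.boundedI) auto
qed

text \<open>The exponent of \<open>E\<close> obeys \<open>w\<^bsub>j+1\<^esub> = \<nu>\<^sub>j w\<^sub>j + b\<^sub>j\<close>. As all \<open>\<nu>\<^sub>j \<ge> 1\<close>, multiplying every \<open>b\<^sub>i\<close> by the full product of
  the \<open>\<nu>\<^sub>j\<close> only enlarges it, and leaves a bound that converges when the product of \<open>\<nu>\<close> and the sum of \<open>b\<close> do.\<close>

lemma max_power_iteration:
  fixes Y b \<mu> \<nu> :: "nat \<Rightarrow> real"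
  assumes Y: "\<And>j. 0 \<le> Y j" and E: "1 \<le> E" and b: "\<And>j. 0 \<le> b j"
    and \<mu>: "\<And>j. 0 \<le> \<mu> j" "\<And>j. \<mu> j \<le> 1" and \<nu>: "\<And>j. 1 \<le> \<nu> j"
    and step: "\<And>j. Y (Suc j) \<le> E powr b j * max (rpow (Y j) (\<mu> j)) (rpow (Y j) (\<nu> j))"
  shows "Y j \<le> E powr ((\<Prod>i<j. \<nu> i) * (\<Sum>i<j. b i)) *
               max (rpow (Y 0) (\<Prod>i<j. \<mu> i)) (rpow (Y 0) (\<Prod>i<j. \<nu> i))"
proof (induction j)
  case 0
  then show ?case using E Y[of 0] by (simp add: rpow_def)
next
  case (Suc j)
  let ?p = "\<Prod>i<j. \<mu> i" and ?q = "\<Prod>i<j. \<nu> i" and ?s = "\<Sum>i<j. b i"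
  have p: "0 \<le> ?p" "?p \<le> 1" using \<mu> by (auto intro: prod_nonneg prod_le_1)
  have q: "1 \<le> ?q" using \<nu> by (auto intro: prod_ge_1)
  have s: "0 \<le> ?s" using b by (auto intro: sum_nonneg)
  let ?M = "max (rpow (Y 0) (?p * \<mu> j)) (rpow (Y 0) (?q * \<nu> j))"
  have "max (rpow (Y j) (\<mu> j)) (rpow (Y j) (\<nu> j)) \<le> E powr (?q * ?s * \<nu> j) * ?M"
    by (rule max_rpow_step) (use Y E p q s \<mu> \<nu> Suc.IH in auto)
  then have "Y (Suc j) \<le> E powr b j * (E powr (?q * ?s * \<nu> j) * ?M)"
    using step[of j] by (meson mult_left_mono order_trans powr_ge_zero)
  also have "\<dots> = E powr (b j + ?q * ?s * \<nu> j) * ?M" by (simp add: powr_add)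
  also have "\<dots> \<le> E powr ((?q * \<nu> j) * (?s + b j)) * ?M"
  proof -
    have "1 \<le> ?q * \<nu> j" using q \<nu>[of j] mult_mono[of 1 ?q 1 "\<nu> j"] by simp
    then have "1 * b j \<le> (?q * \<nu> j) * b j" using b by (intro mult_right_mono)
    then have "b j + ?q * ?s * \<nu> j \<le> (?q * \<nu> j) * (?s + b j)" by (simp add: algebra_simps)
    then show ?thesis using E by (intro mult_right_mono powr_mono) (auto simp: le_max_iff_disj rpow_nonneg)
  qed
  finally show ?case by simp
qed

lemma max_power_iteration_limit:
  fixes Y b \<mu> \<nu> :: "nat \<Rightarrow> real"
  assumes Y: "\<And>j. 0 \<le> Y j" and E: "1 \<le> E" and b: "\<And>j. 0 \<le> b j"
    and \<mu>: "\<And>j. 0 \<le> \<mu> j" "\<And>j. \<mu> j \<le> 1" and \<nu>: "\<And>j. 1 \<le> \<nu> j"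
    and step: "\<And>j. Y (Suc j) \<le> E powr b j * max (rpow (Y j) (\<mu> j)) (rpow (Y j) (\<nu> j))"
    and conv: "summable b" "convergent_prod \<mu>" "convergent_prod \<nu>"
  obtains C where "\<And>j. Y j \<le> C j"
    and "C \<longlonglongrightarrow> E powr (prodinf \<nu> * suminf b) *
                   max (rpow (Y 0) (prodinf \<mu>)) (rpow (Y 0) (prodinf \<nu>))"
proof
  show "Y j \<le> E powr ((\<Prod>i<j. \<nu> i) * (\<Sum>i<j. b i)) *
               max (rpow (Y 0) (\<Prod>i<j. \<mu> i)) (rpow (Y 0) (\<Prod>i<j. \<nu> i))" for j
    by (rule max_power_iteration) (use assms in auto)
  have "(\<lambda>n. \<Prod>i<n. \<nu> i) \<longlonglongrightarrow> prodinf \<nu>"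
    using convergent_prod_LIMSEQ[OF conv(3)] filterlim_sequentially_Suc[of "\<lambda>n. \<Prod>i<n. \<nu> i"]
    by (simp add: lessThan_Suc_atMost)
  then show "(\<lambda>j. E powr ((\<Prod>i<j. \<nu> i) * (\<Sum>i<j. b i)) *
               max (rpow (Y 0) (\<Prod>i<j. \<mu> i)) (rpow (Y 0) (\<Prod>i<j. \<nu> i)))
        \<longlonglongrightarrow> E powr (prodinf \<nu> * suminf b) *
                   max (rpow (Y 0) (prodinf \<mu>)) (rpow (Y 0) (prodinf \<nu>))"
    using E by (intro tendsto_mult tendsto_max tendsto_powr tendsto_const
        tendsto_rpow_prodinf[OF Y] conv summable_LIMSEQ) auto
qed

section \<open>Comparison of \<open>L\<^sup>p\<close> norms\<close>

lemma Lp_norm_nonneg: "0 \<le> Lp_norm p A f"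
  by (simp add: Lp_norm_def)

lemma set_integral_powr_nonneg: "0 \<le> (LINT z:A|lborel. \<bar>f z\<bar> powr p :: real)"
  unfolding set_lebesgue_integral_def by (intro Bochner_Integration.integral_nonneg) auto

text \<open>Hoelder's inequality against the constant function one. By Young's inequality, \<open>\<bar>f\<bar>\<^sup>p\<close> lies below
  an affine function of \<open>\<bar>f\<bar>\<^sup>q\<close> with a free parameter \<open>L > 0\<close>; integrating it over \<open>A\<close> and optimizing \<open>L\<close>
  gives the claim. If \<open>\<bar>f\<bar>\<^sup>p\<close> is not integrable, its Bochner integral has the value zero and the
  bound holds trivially.\<close>

lemma Lp_norm_le_measure_times_Lp_norm:
  fixes A :: "'a::euclidean_space set"
  assumes pq: "0 < p" "p \<le> q" and A: "A \<in> fmeasurable lborel"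
    and int: "set_integrable lborel A (\<lambda>z. \<bar>f z\<bar> powr q)"
  shows "Lp_norm p A f \<le> measure lborel A powr (1 / p - 1 / q) * Lp_norm q A f"
proof -
  define m where "m = measure lborel A"
  define F where "F r = (LINT z:A|lborel. \<bar>f z\<bar> powr r)" for r
  have F0: "0 \<le> F r" for r unfolding F_def by (rule set_integral_powr_nonneg)
  have m0: "0 \<le> m" by (simp add: m_def)
  have As: "A \<in> sets lborel" "emeasure lborel A < \<infinity>" using A by (auto simp: fmeasurable_def)
  have "0 < q" using pq by simp
  have key: "F p \<le> (p / q) * F q * L powr (p / q - 1) + (1 - p / q) * m * L powr (p / q)"
    if L: "0 < L" for L
  proof (cases "set_integrable lborel A (\<lambda>z. \<bar>f z\<bar> powr p)")
    case False
    then have "F p = 0"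
      unfolding F_def set_lebesgue_integral_def set_integrable_def by (rule not_integrable_integral_eq)
    then show ?thesis using pq F0[of q] m0 by (auto intro!: add_nonneg_nonneg mult_nonneg_nonneg)
  next
    case True
    have pt: "\<bar>f z\<bar> powr p \<le> (p / q) * L powr (p / q - 1) * (\<bar>f z\<bar> powr q) + (1 - p / q) * L powr (p / q)" for z
    proof (cases "f z = 0")
      case True
      then show ?thesis using pq by simp
    next
      case False
      have "(\<bar>f z\<bar> powr q) powr (p / q) * L powr (1 - p / q) \<le> (p / q) * (\<bar>f z\<bar> powr q) + (1 - p / q) * L"
        by (rule Youngs_inequality_0) (use False pq L in auto)
      then have "\<bar>f z\<bar> powr p * L powr (1 - p / q) * L powr (p / q - 1) 
          \<le> ((p / q) * (\<bar>f z\<bar> powr q) + (1 - p / q) * L) * L powr (p / q - 1)"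
        using \<open>0 < q\<close> by (intro mult_right_mono) (auto simp: powr_powr)
      moreover have "L powr (1 - p / q) * L powr (p / q - 1) = 1"
        using L by (simp flip: powr_add)
      moreover have "L * L powr (p / q - 1) = L powr (p / q)"
        using L by (simp add: powr_mult_base)
      moreover have "((p / q) * (\<bar>f z\<bar> powr q) + (1 - p / q) * L) * L powr (p / q - 1)
          = (p / q) * L powr (p / q - 1) * (\<bar>f z\<bar> powr q) + (1 - p / q) * (L * L powr (p / q - 1))"
        by (simp only: distrib_left distrib_right mult_ac)
      ultimately show ?thesis by (simp add: mult.assoc)
    qed
    have c: "set_integrable lborel A (\<lambda>z. (1 - p / q) * L powr (p / q))"
      unfolding set_integrable_def using As by simp
    have i: "set_integrable lborel A (\<lambda>z. (p / q) * L powr (p / q - 1) * (\<bar>f z\<bar> powr q))"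
      using int by (rule set_integrable_mult_right)
    have "F p \<le> (LINT z:A|lborel. (p / q) * L powr (p / q - 1) * (\<bar>f z\<bar> powr q) + (1 - p / q) * L powr (p / q))"
      unfolding F_def by (rule set_integral_mono[OF True]) (use c i pt in auto)
    also have "\<dots> = (p / q) * L powr (p / q - 1) * F q + (1 - p / q) * L powr (p / q) * m"
      unfolding F_def m_def using i c As
      by (simp add: set_integral_add set_integral_mult_right set_integral_const)
    finally show ?thesis by (simp add: algebra_simps)
  qed
  have main: "F p \<le> F q powr (p / q) * m powr (1 - p / q)"
  proof -
    consider "m = 0" | "p = q" "0 < m" | "p < q" "0 < m" "F q = 0" | "p < q" "0 < m" "0 < F q"
      using pq m0 F0[of q] by fastforce
    then show ?thesis
    proof cases
      case 1
      then have "A \<in> null_sets lborel"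
        using As unfolding m_def null_sets_def by (auto simp: measure_def enn2real_eq_0_iff)
      then have "AE z in lborel. z \<notin> A" by (rule AE_not_in)
      then have "AE z in lborel. indicator A z *\<^sub>R (\<bar>f z\<bar> powr p) = 0" by eventually_elim auto
      then have "F p = 0"
        unfolding F_def set_lebesgue_integral_def by (rule integral_eq_zero_AE)
      then show ?thesis by simp
    next
      case 2
      then show ?thesis using F0[of q] \<open>0 < q\<close> by simp
    next
      case 3
      have "((\<lambda>L. (1 - p / q) * m * L powr (p / q)) \<longlongrightarrow> (1 - p / q) * m * 0) (at_right 0)"
        using pq by (intro tendsto_mult tendsto_const) (auto intro!: tendsto_eq_intros simp: eventually_at_filter)
      moreover have "\<forall>\<^sub>F L in at_right 0. F p \<le> (1 - p / q) * m * L powr (p / q)"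
        using eventually_at_right_less[of 0] by eventually_elim (use key 3 in auto)
      ultimately have "F p \<le> 0"
        using tendsto_lowerbound[of _ _ "at_right 0" "F p"] by fastforce
      then show ?thesis using m0 by (meson mult_nonneg_nonneg order_trans powr_ge_zero)
    next
      case 4
      \<comment> \<open>The mean value of \<open>\<bar>f\<bar>\<^sup>q\<close> balances the two terms of the bound, which then add up
        with the weights \<open>p / q\<close> and \<open>1 - p / q\<close>.\<close>
      define L where "L = F q / m"
      have L: "0 < L" using 4 by (simp add: L_def)
      have "F q * L powr (p / q - 1) = m * (L * L powr (p / q - 1))"
        using 4 by (simp add: L_def)
      also have "\<dots> = m * L powr (p / q)" using L by (simp add: powr_mult_base)
      finally have eq: "F q * L powr (p / q - 1) = m * L powr (p / q)" .
      have "F p \<le> (p / q) * (F q * L powr (p / q - 1)) + (1 - p / q) * (m * L powr (p / q))"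
        using key[OF L] by (simp add: mult.assoc)
      also have "\<dots> = m * L powr (p / q)" unfolding eq by (simp add: algebra_simps)
      also have "\<dots> = F q powr (p / q) * m powr (1 - p / q)"
        using 4 by (simp add: L_def powr_divide powr_diff)
      finally show ?thesis .
    qed
  qed
  have "F p powr (1 / p) \<le> (F q powr (p / q) * m powr (1 - p / q)) powr (1 / p)"
    using main F0 pq by (intro powr_mono2) auto
  also have "\<dots> = m powr (1 / p - 1 / q) * F q powr (1 / q)"
  proof -
    have "(1 - p / q) * (1 / p) = 1 / p - 1 / q" "p / q * (1 / p) = 1 / q"
      using pq by (auto simp: field_simps)
    then show ?thesis using F0[of q] m0 by (simp add: powr_mult powr_powr)
  qed
  finally show ?thesis by (simp add: Lp_norm_def F_def m_def)
qed

lemma Lp_norm_mono_set: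
  assumes "A \<subseteq> B" "A \<in> sets lborel" "0 < p" "set_integrable lborel B (\<lambda>z. \<bar>f z\<bar> powr p)"
  shows "Lp_norm p A f \<le> Lp_norm p B f"
proof -
  have "(LINT z:A|lborel. \<bar>f z\<bar> powr p) \<le> (LINT z:B|lborel. \<bar>f z\<bar> powr p)"
    unfolding set_lebesgue_integral_def
    using assms set_integrable_subset[OF assms(4,2,1)]
    by (intro integral_mono) (auto simp: set_integrable_def split: split_indicator)
  then show ?thesis unfolding Lp_norm_def using \<open>0 < p\<close> set_integral_powr_nonneg
    by (intro powr_mono2) auto
qed

text \<open>For \<open>M > c\<close>, Markov's inequality bounds the measure of the set where \<open>\<bar>f\<bar> \<ge> M\<close> by
  \<open>(C\<^sub>j / M)\<close> to the power \<open>p\<^sub>j\<close>. The base tends to \<open>c / M < 1\<close> and the exponent to infinity, so the set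
  is null.\<close>

lemma Linf_norm_le_of_Lp_norm_le:
  fixes A :: "'a::euclidean_space set" and p C :: "nat \<Rightarrow> real"
  assumes A: "A \<in> sets lborel" and f: "f \<in> borel_measurable (restrict_space lborel A)"
    and p: "\<And>j. 0 < p j" "filterlim p at_top sequentially"
    and int: "\<And>j. set_integrable lborel A (\<lambda>z. \<bar>f z\<bar> powr p j)"
    and le: "\<And>j. Lp_norm (p j) A f \<le> C j" and lim: "C \<longlonglongrightarrow> c"
  shows "Linf_norm A f \<le> ereal c"
proof -
  have C0: "0 \<le> C j" for j using le[of j] Lp_norm_nonneg[of "p j" A f] by linarith
  have c0: "0 \<le> c" using lim C0 by (intro LIMSEQ_le_const) auto
  have bound: "Linf_norm A f \<le> ereal M" if M: "c < M" for M
  proof -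
    have Mpos: "0 < M" using c0 M by simp
    define S where "S = {z \<in> A. M \<le> \<bar>f z\<bar>}"
    have small: "emeasure lborel S \<le> ennreal ((C j / M) powr p j)" for j
    proof -
      let ?F = "LINT z:A|lborel. \<bar>f z\<bar> powr p j"
      have "emeasure lborel {z \<in> space lborel. M powr p j \<le> indicator A z *\<^sub>R (\<bar>f z\<bar> powr p j)}
            \<le> ennreal (1 / M powr p j * ?F)"
        unfolding set_lebesgue_integral_def
        by (rule integral_Markov_inequality) (use int[of j] Mpos in \<open>auto simp: set_integrable_def\<close>)
      moreover have "{z \<in> space lborel. M powr p j \<le> indicator A z *\<^sub>R (\<bar>f z\<bar> powr p j)} = S"
        using Mpos p(1)[of j] unfolding S_def
        by (auto simp: indicator_def intro: powr_mono2 dest: powr_less_mono2[of "p j", rotated 2] split: if_splits)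
           (metis abs_ge_zero not_less powr_less_mono2)
      moreover have "?F \<le> C j powr p j"
      proof -
        have "?F = Lp_norm (p j) A f powr p j"
          unfolding Lp_norm_def using p(1)[of j] set_integral_powr_nonneg[where A = A and f = f and p = "p j"]
          by (simp add: powr_powr)
        also have "\<dots> \<le> C j powr p j"
          using p(1)[of j] le[of j] Lp_norm_nonneg[of "p j" A f] by (intro powr_mono2) auto
        finally show ?thesis .
      qed
      then have "1 / M powr p j * ?F \<le> (C j / M) powr p j"
        using Mpos C0[of j] by (simp add: powr_divide divide_right_mono)
      ultimately show ?thesis
        by (metis ennreal_leI order_trans)
    qed
    have "(\<lambda>j. (C j / M) powr p j) \<longlonglongrightarrow> 0"
    proof -
      obtain r where r: "c / M < r" "r < 1" using M Mpos dense[of "c / M" 1] by auto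
      have r0: "0 < r" using r c0 Mpos by (meson divide_nonneg_pos le_less_trans)
      have "(\<lambda>j. C j / M) \<longlonglongrightarrow> c / M" using lim Mpos by (intro tendsto_intros) auto
      then have "\<forall>\<^sub>F j in sequentially. C j / M < r" using r(1) by (rule order_tendstoD)
      then have up: "\<forall>\<^sub>F j in sequentially. (C j / M) powr p j \<le> r powr p j"
        by eventually_elim (use C0 Mpos p in \<open>auto intro!: powr_mono2 simp: less_imp_le\<close>)
      have "((\<lambda>x. r powr x) \<longlongrightarrow> 0) at_top" using r r0 by real_asymp
      then have "(\<lambda>j. r powr p j) \<longlonglongrightarrow> 0" using p(2) by (rule filterlim_compose)
      then show ?thesis
        by (rule tendsto_sandwich[OF _ up tendsto_const, rotated]) auto
    qed
    then have "(\<lambda>j. ennreal ((C j / M) powr p j)) \<longlonglongrightarrow> ennreal 0" by (rule tendsto_ennrealI)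
    then have S0: "emeasure lborel S = 0"
      using small by (intro antisym LIMSEQ_le_const) auto
    have Sm: "S \<in> sets lborel"
    proof -
      have "{z \<in> space (restrict_space lborel A). M \<le> \<bar>f z\<bar>} \<in> sets (restrict_space lborel A)"
        using f by measurable
      then show ?thesis using A by (auto simp: S_def space_restrict_space sets_restrict_space_iff)
    qed
    then have "AE z in lborel. z \<notin> S" using S0 by (intro AE_not_in) auto
    then have "AE z in restrict_space lborel A. ereal \<bar>f z\<bar> \<le> ereal M"
      using A by (subst AE_restrict_space_iff) (auto simp: S_def elim!: eventually_mono)
    then show ?thesis unfolding Linf_norm_def using f by (intro esssup_I) auto
  qed
  show ?thesis
  proof (rule dense_ge)
    fix x :: ereal assume "ereal c < x"
    then show "Linf_norm A f \<le> x" using bound by (cases x) auto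
  qed
qed

lemma continuous_on_compact_imp_set_integrable_powr:
  fixes f :: "'a::euclidean_space \<Rightarrow> real"
  assumes "compact K" "continuous_on K f" "A \<in> sets lborel" "A \<subseteq> K" "0 < p"
  shows "set_integrable lborel A (\<lambda>z. \<bar>f z\<bar> powr p)"
proof (rule set_integrable_subset[OF _ assms(3,4)])
  show "set_integrable lborel K (\<lambda>z. \<bar>f z\<bar> powr p)"
    unfolding set_integrable_def using assms
    by (intro borel_integrable_compact continuous_on_powr' continuous_intros) auto
qed

text \<open>One application of a gain of integrability, put into the form that is iterated. The gain reaches an
  exponent \<open>q'\<close> that may exceed the next exponent \<open>q\<close> of the iteration. Lowering \<open>q'\<close> to \<open>q\<close> costs
  a power of the measure with exponent at most \<open>1 / \<alpha>\<close>, which is absorbed by a factor \<open>W\<close>; the factor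
  \<open>2\<close> turns the sum of the two powers into a maximum.\<close>

lemma Lp_norm_step:
  fixes B :: "'a::euclidean_space set"
  assumes \<alpha>: "0 < \<alpha>" "\<alpha> \<le> q" "q \<le> q'" and B: "B \<in> fmeasurable lborel"
    and int: "set_integrable lborel B (\<lambda>z. \<bar>f z\<bar> powr q')"
    and W: "measure lborel B \<le> W" "1 \<le> W" and A: "0 \<le> A" and Y: "0 \<le> Y"
    and rs: "0 \<le> r" "0 \<le> s"
    and le: "Lp_norm q' B f \<le> A powr (1 / \<alpha>) * (rpow Y r + rpow Y s) powr (1 / \<alpha>)"
  shows "Lp_norm q B f \<le> (2 * W * A) powr (1 / \<alpha>) * max (rpow Y (r / \<alpha>)) (rpow Y (s / \<alpha>))"
proof -
  have q: "0 < q" "0 < q'" using \<alpha> by auto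
  have "1 / q' \<le> 1 / q" "1 / q \<le> 1 / \<alpha>" "0 \<le> 1 / q'" using \<alpha> q by (auto intro: frac_le)
  then have "0 \<le> 1 / q - 1 / q'" "1 / q - 1 / q' \<le> 1 / \<alpha>" by linarith+
  then have "measure lborel B powr (1 / q - 1 / q') \<le> W powr (1 / \<alpha>)"
    using W by (intro order_trans[OF powr_mono2[of _ _ W] powr_mono]) auto
  then have "measure lborel B powr (1 / q - 1 / q') * Lp_norm q' B f
      \<le> W powr (1 / \<alpha>) * (A powr (1 / \<alpha>) * (rpow Y r + rpow Y s) powr (1 / \<alpha>))"
    using le by (intro mult_mono) (auto simp: Lp_norm_nonneg)
  moreover have "(rpow Y r + rpow Y s) powr (1 / \<alpha>)
      \<le> 2 powr (1 / \<alpha>) * max (rpow Y (r / \<alpha>)) (rpow Y (s / \<alpha>))"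
  proof -
    have "(rpow Y r + rpow Y s) powr (1 / \<alpha>) \<le> (2 * max (rpow Y r) (rpow Y s)) powr (1 / \<alpha>)"
      using \<alpha> by (intro powr_mono2) (auto simp: rpow_nonneg add_nonneg_nonneg)
    also have "\<dots> = 2 powr (1 / \<alpha>) * rpow (max (rpow Y r) (rpow Y s)) (1 / \<alpha>)"
      using \<alpha> by (simp add: powr_mult rpow_def)
    also have "rpow (max (rpow Y r) (rpow Y s)) (1 / \<alpha>) = max (rpow Y (r / \<alpha>)) (rpow Y (s / \<alpha>))"
      using \<alpha> by (simp add: rpow_max rpow_nonneg rpow_rpow)
    finally show ?thesis .
  qed
  ultimately have "measure lborel B powr (1 / q - 1 / q') * Lp_norm q' B f
      \<le> W powr (1 / \<alpha>) * (A powr (1 / \<alpha>) * (2 powr (1 / \<alpha>) * max (rpow Y (r / \<alpha>)) (rpow Y (s / \<alpha>))))"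
    by (meson mult_left_mono order_trans powr_ge_zero)
  also have "\<dots> = (2 * W * A) powr (1 / \<alpha>) * max (rpow Y (r / \<alpha>)) (rpow Y (s / \<alpha>))"
    using W A by (simp add: powr_mult)
  finally show ?thesis
    using Lp_norm_le_measure_times_Lp_norm[OF q(1) \<alpha>(3) B int] by linarith
qed

section \<open>Growth of the constants and convergence of the exponents\<close>

text \<open>Here \<open>h = 2\<^sup>j\<close> at stage \<open>j\<close>. The terms with \<open>\<rho>\<close> lose a factor \<open>4\<close> from \<open>1 + 1 / \<rho> \<le> 2 (1 + 1 / R)\<close>. The
  gaps in time and radius lose at most \<open>16 h\<^sup>2\<close>, hence \<open>2\<^sup>8 h\<^sup>4\<close> after squaring. With the
  leading \<open>2\<close> this makes the constant \<open>2\<^bsup>11\<^esup>\<close>.\<close>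

lemma A_const_dyadic_bound:
  assumes a: "0 < a" "a < 1" and c: "0 \<le> c" and vol: "0 \<le> vol" "vol \<le> V"
    and pos: "0 < R" "0 < T" "0 < \<tau>" "1 \<le> h"
    and \<rho>: "R / 2 \<le> \<rho>" "R' - \<rho> = R / (4 * h)" and t: "T2 - T1 = \<tau> / (2 * h)"
  shows "2 * (1 + V * T) * A_const c a \<alpha> vol \<rho> R' T1 T2 T \<le>
         (2^11 * c * \<alpha> powr (6 - a) * (1 + 1 / R)^2 * (1 + V * T)^3 *
          (1 + 1 / \<tau> + 1 / R powr (2 - a))^2) * h^4"
proof -
  have \<rho>0: "0 < \<rho>" using \<rho> pos by simp
  have "1 / \<rho> \<le> 2 / R" using \<rho> \<rho>0 pos by (simp add: field_simps)
  then have "1 + 1 / \<rho> \<le> 2 * (1 + 1 / R)" by simp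
  then have "(1 + 1 / \<rho>) powr (2 - a) \<le> (2 * (1 + 1 / R)) powr (2 - a)"
    using a \<rho>0 by (intro powr_mono2) auto
  also have "\<dots> \<le> (2 * (1 + 1 / R)) powr 2"
    using a pos by (intro powr_mono) (auto simp: field_simps)
  also have "\<dots> = 4 * (1 + 1 / R)^2" using pos by (subst powr_numeral) (auto simp: power_mult_distrib simp del: distrib_left_numeral intro: add_pos_pos)
  finally have 1: "(1 + 1 / \<rho>) powr (2 - a) \<le> 4 * (1 + 1 / R)^2" .
  have 2: "(1 + vol * T)^2 \<le> (1 + V * T)^2"
    using vol pos by (intro power_mono add_left_mono mult_right_mono) auto
  have hh: "1 \<le> 16 * h^2" "2 * h \<le> 16 * h^2"
    using pos power_mono[of 1 h 2] mult_mono[of 1 h h h] by (auto simp: power2_eq_square)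
  have "(4 * h) powr (2 - a) \<le> (4 * h) powr 2"
    using a pos by (intro powr_mono) auto
  also have "\<dots> = 16 * h^2" using pos by (simp add: powr_numeral power_mult_distrib)
  finally have h4: "(4 * h) powr (2 - a) \<le> 16 * h^2" .
  have "1 / (T2 - T1) \<le> 16 * h^2 * (1 / \<tau>)"
    unfolding t using hh(2) pos by (simp add: divide_right_mono)
  moreover have "1 / (R' - \<rho>) powr (2 - a) = (4 * h) powr (2 - a) * (1 / R powr (2 - a))"
    unfolding \<rho>(2) using pos by (simp add: powr_divide)
  moreover have "(4 * h) powr (2 - a) * (1 / R powr (2 - a)) \<le> 16 * h^2 * (1 / R powr (2 - a))"
    using h4 by (intro mult_right_mono) auto
  ultimately have "1 + 1 / (T2 - T1) + 1 / (R' - \<rho>) powr (2 - a)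
      \<le> 16 * h^2 * (1 + 1 / \<tau> + 1 / R powr (2 - a))"
    using hh(1) by (simp only: distrib_left)
  moreover have "0 \<le> 1 + 1 / (T2 - T1) + 1 / (R' - \<rho>) powr (2 - a)"
    unfolding t using pos by (intro add_nonneg_nonneg) auto
  ultimately have "(1 + 1 / (T2 - T1) + 1 / (R' - \<rho>) powr (2 - a))^2
      \<le> (16 * h^2 * (1 + 1 / \<tau> + 1 / R powr (2 - a)))^2"
    by (intro power_mono)
  also have "\<dots> = 256 * h^4 * (1 + 1 / \<tau> + 1 / R powr (2 - a))^2"
    by (simp add: power_mult_distrib flip: power_mult)
  finally have 3: "(1 + 1 / (T2 - T1) + 1 / (R' - \<rho>) powr (2 - a))^2
      \<le> 256 * h^4 * (1 + 1 / \<tau> + 1 / R powr (2 - a))^2" .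
  have V0: "0 \<le> V * T" using vol pos by simp
  have "2 * (1 + V * T) * A_const c a \<alpha> vol \<rho> R' T1 T2 T
     \<le> 2 * (1 + V * T) * (c * (4 * (1 + 1 / R)^2) * \<alpha> powr (6 - a) * (1 + V * T)^2 *
        (256 * h^4 * (1 + 1 / \<tau> + 1 / R powr (2 - a))^2))"
    unfolding A_const_def using c V0
    by (intro mult_left_mono mult_mono 1 2 3) (auto intro!: mult_nonneg_nonneg)
  also have "\<dots> = (2^11 * c * \<alpha> powr (6 - a) * (1 + 1 / R)^2 * (1 + V * T)^3 *
          (1 + 1 / \<tau> + 1 / R powr (2 - a))^2) * h^4"
  proof -
    have "2 * W * (c * (4 * r) * p * W^2 * (256 * k * q)) = (2^11 * c * p * r * W^3 * q) * k"
      for W r p q k :: real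
      by (simp add: power3_eq_cube power2_eq_square)
    then show ?thesis .
  qed
  finally show ?thesis .
qed

lemma
  fixes \<kappa> \<alpha>0 d :: real
  assumes \<alpha>0: "0 < \<alpha>0" and \<kappa>: "1 < \<kappa>"
  shows summable_inverse_geometric: "summable (\<lambda>j. 1 / (\<alpha>0 * \<kappa> ^ j))"
    and summable_affine_over_geometric: "summable (\<lambda>j. (1 + d * real j) / (\<alpha>0 * \<kappa> ^ j))"
proof -
  have z: "norm (1 / \<kappa>) < 1" using \<kappa> by simp
  have geo: "summable (\<lambda>j. (1 / \<kappa>) ^ j)" using z by (rule summable_geometric)
  show "summable (\<lambda>j. 1 / (\<alpha>0 * \<kappa> ^ j))"
    using summable_mult[OF geo, of "1 / \<alpha>0"] by (simp add: power_divide)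
  have "summable (\<lambda>j. (1 - d) / \<alpha>0 * (1 / \<kappa>) ^ j + d / \<alpha>0 * (of_nat (Suc j) * (1 / \<kappa>) ^ j))"
    by (intro summable_add summable_mult geo sums_summable[OF geometric_deriv_sums[OF z]])
  also have "(\<lambda>j. (1 - d) / \<alpha>0 * (1 / \<kappa>) ^ j + d / \<alpha>0 * (of_nat (Suc j) * (1 / \<kappa>) ^ j))
      = (\<lambda>j. (1 + d * real j) / (\<alpha>0 * \<kappa> ^ j))"
    using \<alpha>0 \<kappa> by (intro ext) (simp add: field_simps)
  finally show "summable (\<lambda>j. (1 + d * real j) / (\<alpha>0 * \<kappa> ^ j))" .
qed

lemma convergent_prod_mu_factors:
  assumes \<alpha>0: "0 < \<alpha>0" and \<kappa>: "1 < \<kappa>"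
  shows "convergent_prod (\<lambda>j. (\<alpha>0 * \<kappa> ^ j - 2 + \<delta>) / (\<alpha>0 * \<kappa> ^ j) :: real)"
proof (intro abs_convergent_prod_imp_convergent_prod summable_imp_abs_convergent_prod)
  have "norm ((\<alpha>0 * \<kappa> ^ j - 2 + \<delta>) / (\<alpha>0 * \<kappa> ^ j) - 1) = \<bar>\<delta> - 2\<bar> * (1 / (\<alpha>0 * \<kappa> ^ j))" for j
  proof -
    have "(\<alpha>0 * \<kappa> ^ j - 2 + \<delta>) / (\<alpha>0 * \<kappa> ^ j) - 1 = (\<delta> - 2) / (\<alpha>0 * \<kappa> ^ j)"
      using \<alpha>0 \<kappa> by (simp add: field_simps)
    then show ?thesis using \<alpha>0 \<kappa> by (simp add: abs_mult)
  qed
  then show "summable (\<lambda>j. norm ((\<alpha>0 * \<kappa> ^ j - 2 + \<delta>) / (\<alpha>0 * \<kappa> ^ j) - 1))"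
    using summable_mult[OF summable_inverse_geometric[OF assms]] by simp
qed

text \<open>A factor differs from one by \<open>(a - \<delta>) / (\<alpha>\<^sub>j + \<delta> - a)\<close> with \<open>\<alpha>\<^sub>j = \<alpha>0 \<kappa>\<^sup>j\<close>. As \<open>\<alpha>0 > a - \<delta>\<close>, the denominator is at
  least the fixed fraction \<open>\<theta>\<close> of \<open>\<alpha>\<^sub>j\<close>, so these differences decay geometrically.\<close>

lemma convergent_prod_nu_factors:
  assumes \<alpha>0: "0 < \<alpha>0" "a - \<delta> < \<alpha>0" and \<kappa>: "1 < \<kappa>" and a: "\<delta> \<le> a"
  shows "convergent_prod (\<lambda>j. \<alpha>0 * \<kappa> ^ j / (\<alpha>0 * \<kappa> ^ j + \<delta> - a) :: real)"
proof (intro abs_convergent_prod_imp_convergent_prod summable_imp_abs_convergent_prod)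
  define \<theta> where "\<theta> = 1 - (a - \<delta>) / \<alpha>0"
  have \<theta>: "0 < \<theta>" using \<alpha>0 by (simp add: \<theta>_def)
  have bound: "norm (norm (\<alpha>0 * \<kappa> ^ j / (\<alpha>0 * \<kappa> ^ j + \<delta> - a) - 1)) \<le> (a - \<delta>) / \<theta> * (1 / (\<alpha>0 * \<kappa> ^ j))" for j
  proof -
    define x where "x = \<alpha>0 * \<kappa> ^ j"
    have \<alpha>: "\<alpha>0 \<le> x" using \<alpha>0 \<kappa> by (simp add: x_def)
    define y where "y = (a - \<delta>) * (x / \<alpha>0)"
    have "a - \<delta> \<le> y"
      using mult_left_mono[of 1 "x / \<alpha>0" "a - \<delta>"] \<alpha> \<alpha>0 a by (simp add: y_def)
    moreover have "\<theta> * x = x - y" using \<alpha>0(1) by (simp add: \<theta>_def y_def field_simps)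
    ultimately have den: "\<theta> * x \<le> x + \<delta> - a" by linarith
    have p: "0 < \<theta> * x" using \<theta> \<alpha> \<alpha>0 by simp
    then have p2: "0 < x + \<delta> - a" using den by linarith
    then have "x / (x + \<delta> - a) - 1 = (a - \<delta>) / (x + \<delta> - a)" by (simp add: field_simps)
    then have "norm (norm (x / (x + \<delta> - a) - 1)) = (a - \<delta>) / (x + \<delta> - a)" using p2 a by simp
    also have "\<dots> \<le> (a - \<delta>) / (\<theta> * x)" by (rule frac_le) (use den p a in auto)
    finally show ?thesis by (simp add: x_def)
  qed
  show "summable (\<lambda>j. norm (\<alpha>0 * \<kappa> ^ j / (\<alpha>0 * \<kappa> ^ j + \<delta> - a) - 1))"
    by (rule summable_comparison_test'[OF summable_mult[OF summable_inverse_geometric[OF \<alpha>0(1) \<kappa>]] bound])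
qed

section \<open>The local supremum bound\<close>

lemma cylinder_in_sets: "ball x r \<times> {s<..<t::real} \<in> sets lborel"
  for x :: "'a::euclidean_space"
  by (auto intro!: borel_open open_Times)

lemma measure_cylinder:
  fixes x :: "'a::euclidean_space"
  assumes "s \<le> t"
  shows "measure lborel (ball x r \<times> {s<..<t::real}) = measure lborel (ball x r) * (t - s)"
proof -
  have "emeasure lborel (ball x r \<times> {s<..<t}) = emeasure lborel (ball x r) * emeasure lborel {s<..<t}"
    unfolding lborel_prod[symmetric] by (rule lborel.emeasure_pair_measure_Times) auto
  then show ?thesis using assms by (simp add: measure_def enn2real_mult)
qed

theorem theorem5p3:
  fixes N :: nat and c \<gamma> :: "nat \<Rightarrow> real" and g K :: "real \<Rightarrow> real"
    and a lam \<delta> c10 \<alpha>0 \<kappa>s :: real and n :: nat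
  assumes n: "n = CARD('n::finite)" "n \<ge> 2"
    and N: "N \<ge> 1"
    and \<gamma>: "\<gamma> 0 = 0" "\<And>i. i < N \<Longrightarrow> \<gamma> i < \<gamma> (Suc i)"
    and c: "\<And>i. i \<le> N \<Longrightarrow> c i > 0"
    and g: "g = g_fun N c \<gamma>"
    and K: "K = K_fun g"
    and a: "a = \<gamma> N / (\<gamma> N + 1)"
    and lam: "0 < lam" "lam \<le> 1"
    and \<delta>: "\<delta> = 1 - lam" "a > \<delta>"
    and c10_ge_1: "c10 \<ge> 1"
    and c10_estimate:
      "\<And>(U :: (real^'n) set) u0 \<phi> u \<alpha> x \<rho> R T1 T2 T.
         \<lbrakk>bounded_C1_domain U; nonneg_solution_P K lam U u0 \<phi> u;
          \<alpha> \<ge> 2 - \<delta>; \<alpha> > alpha_star n a \<delta>;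
          0 < \<rho>; \<rho> < R; in_compact_subset (ball x R) U;
          0 \<le> T1; T1 < T2; T2 < T\<rbrakk>
         \<Longrightarrow> Lp_norm (kappa n a \<delta> \<alpha> * \<alpha>) (ball x \<rho> \<times> {T2<..<T}) u
             \<le> A_const c10 a \<alpha> (measure lborel (ball x R)) \<rho> R T1 T2 T powr (1 / \<alpha>) *
               (rpow (Lp_norm \<alpha> (ball x R \<times> {T1<..<T}) u) (\<alpha> + \<delta> - 2) +
                rpow (Lp_norm \<alpha> (ball x R \<times> {T1<..<T}) u) (\<alpha>\<^sup>2 / (\<alpha> + \<delta> - a))) powr (1 / \<alpha>)"
    and \<alpha>0: "\<alpha>0 > 0" "\<alpha>0 \<ge> 2 - \<delta>" "\<alpha>0 > alpha_star n a \<delta>"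
    and \<kappa>s: "\<kappa>s = kappa n a \<delta> \<alpha>0"
  shows "\<exists>\<omega>>0. \<forall>(U :: (real^'n) set) u0 \<phi> u x R T \<sigma>.
           bounded_C1_domain U \<and> nonneg_solution_P K lam U u0 \<phi> u \<and>
           R > 0 \<and> in_compact_subset (ball x R) U \<and> T > 0 \<and> 0 < \<sigma> \<and> \<sigma> < 1 \<longrightarrow>
           Linf_norm (ball x (R / 2) \<times> {\<sigma> * T<..<T}) u
           \<le> ereal (C_hat c10 a \<alpha>0 \<omega> (measure lborel (ball x R)) R T \<sigma> *
               max (rpow (Lp_norm \<alpha>0 (ball x R \<times> {0<..<T}) u) (mu_exp \<delta> \<alpha>0 \<kappa>s))
                   (rpow (Lp_norm \<alpha>0 (ball x R \<times> {0<..<T}) u) (nu_exp a \<delta> \<alpha>0 \<kappa>s)))"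
proof -
  have n0: "0 < n" using n by simp
  have \<gamma>_pos: "0 < \<gamma> i" if "1 \<le> i" "i \<le> N" for i
    using that
  proof (induction i rule: nat_induct_at_least)
    case base
    then show ?case using \<gamma>(1) \<gamma>(2)[of 0] by simp
  next
    case (Suc i)
    then show ?case using \<gamma>(2)[of i] by simp
  qed
  have a01: "0 < a" "a < 1" using \<gamma>_pos[of N] N unfolding a by (auto simp: field_simps)
  have \<delta>01: "0 \<le> \<delta>" "\<delta> < 1" using \<delta>(1) lam by auto
  have \<alpha>0_1: "1 < \<alpha>0" using \<alpha>0(2) \<delta>01 by simp

  have \<kappa>1: "1 < \<kappa>s"
  proof -
    have "real n * (a - \<delta>) < \<alpha>0 * (2 - a)"
      using \<alpha>0(3) a01 by (simp add: alpha_star_def divide_less_eq)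
    then have "(a - \<delta>) / \<alpha>0 < (2 - a) / real n"
      using \<alpha>0(1) n0 by (simp add: field_simps)
    then show ?thesis by (simp add: \<kappa>s kappa_def)
  qed

  define \<alpha> where "\<alpha> j = \<alpha>0 * \<kappa>s ^ j" for j
  define \<mu> where "\<mu> j = (\<alpha> j - 2 + \<delta>) / \<alpha> j" for j
  define \<nu> where "\<nu> j = \<alpha> j / (\<alpha> j + \<delta> - a)" for j
  \<comment> \<open>\<open>D\<close> is the growth of the constants from one stage to the next. It is written as a power of
    \<open>2\<^bsup>11\<^esup>\<close>, which bounds from below the base \<open>E\<close> of the final constant for every cylinder, so that
    \<open>d\<close> and with it \<open>\<omega>\<close> depend neither on the solution nor on the cylinder.\<close>
  define D where "D = 16 * \<kappa>s powr (6 - a)"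
  define d where "d = log (2^11) D"
  define b where "b j = (1 + d * real j) / \<alpha> j" for j
  define \<omega> where "\<omega> = prodinf \<nu> * suminf b"

  have \<alpha>_ge: "\<alpha>0 \<le> \<alpha> j" for j using \<alpha>0(1) \<kappa>1 by (simp add: \<alpha>_def)
  have \<alpha>_pos: "0 < \<alpha> j" for j using \<alpha>_ge[of j] \<alpha>0(1) by simp
  have den_pos: "0 < \<alpha> j + \<delta> - a" for j using \<alpha>_ge[of j] \<alpha>0_1 \<delta>01 a01 by linarith
  have \<mu>01: "0 \<le> \<mu> j" "\<mu> j \<le> 1" for j
    using \<alpha>_pos[of j] \<alpha>_ge[of j] \<alpha>0(2) \<delta>01 by (auto simp: \<mu>_def field_simps)
  have \<nu>1: "1 \<le> \<nu> j" for j using den_pos[of j] \<delta>(2) by (simp add: \<nu>_def field_simps)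
  have D1: "1 \<le> D"
    using ge_one_powr_ge_zero[of \<kappa>s "6 - a"] \<kappa>1 a01 by (simp add: D_def)
  have d0: "0 \<le> d" using D1 by (simp add: d_def)
  have D_eq: "D = (2^11) powr d" using D1 by (simp add: d_def)
  have b0: "0 \<le> b j" for j using d0 \<alpha>_pos[of j] by (simp add: b_def)
  have summable_b: "summable b"
    unfolding b_def \<alpha>_def by (rule summable_affine_over_geometric[OF \<alpha>0(1) \<kappa>1])
  have conv_\<mu>: "convergent_prod \<mu>"
    unfolding \<mu>_def \<alpha>_def by (rule convergent_prod_mu_factors[OF \<alpha>0(1) \<kappa>1])
  have conv_\<nu>: "convergent_prod \<nu>"
    unfolding \<nu>_def \<alpha>_def
    by (rule convergent_prod_nu_factors) (use \<alpha>0_1 a01 \<delta>01 \<delta>(2) \<kappa>1 in auto)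
  have \<mu>_inf: "prodinf \<mu> = mu_exp \<delta> \<alpha>0 \<kappa>s" by (simp add: mu_exp_def \<mu>_def[abs_def] \<alpha>_def)
  have \<nu>_inf: "prodinf \<nu> = nu_exp a \<delta> \<alpha>0 \<kappa>s" by (simp add: nu_exp_def \<nu>_def[abs_def] \<alpha>_def)

  have \<omega>_pos: "0 < \<omega>"
  proof -
    have "1 \<le> prodinf \<nu>" by (rule prodinf_nonneg[OF convergent_prod_has_prod[OF conv_\<nu>] \<nu>1])
    moreover have "0 < b 0" using \<alpha>_pos[of 0] by (simp add: b_def)
    then have "0 < suminf b" using suminf_pos_iff[OF summable_b b0] by blast
    ultimately show ?thesis by (simp add: \<omega>_def)
  qed

  have "Linf_norm (ball x (R / 2) \<times> {\<sigma> * T<..<T}) u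
           \<le> ereal (C_hat c10 a \<alpha>0 \<omega> (measure lborel (ball x R)) R T \<sigma> *
               max (rpow (Lp_norm \<alpha>0 (ball x R \<times> {0<..<T}) u) (mu_exp \<delta> \<alpha>0 \<kappa>s))
                   (rpow (Lp_norm \<alpha>0 (ball x R \<times> {0<..<T}) u) (nu_exp a \<delta> \<alpha>0 \<kappa>s)))"
    if U: "bounded_C1_domain U" and sol: "nonneg_solution_P K lam U u0 \<phi> u"
      and R: "R > 0" and ball_U: "in_compact_subset (ball x R) U"
      and T: "T > 0" and \<sigma>: "0 < \<sigma>" "\<sigma> < 1"
    for U :: "(real^'n) set" and u0 \<phi> u x R T \<sigma>
  proof -
    define \<rho> where "\<rho> j = R / 2 * (1 + 1 / 2 ^ j)" for j :: nat
    define t where "t j = \<sigma> * T * (1 - 1 / 2 ^ j)" for j :: nat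
    define Q where "Q j = ball x (\<rho> j) \<times> {t j<..<T}" for j
    define V where "V = measure lborel (ball x R)"
    define E where "E = 2^11 * c10 * \<alpha>0 powr (6 - a) * (1 + 1 / R)^2 * (1 + V * T)^3 *
      (1 + 1 / (\<sigma> * T) + 1 / R powr (2 - a))^2"
    define Y where "Y j = Lp_norm (\<alpha> j) (Q j) u" for j
    let ?Qlim = "ball x (R / 2) \<times> {\<sigma> * T<..<T}"

    have \<sigma>T: "0 < \<sigma> * T" "\<sigma> * T < T" using \<sigma> T by auto
    have \<rho>_bounds: "R / 2 \<le> \<rho> j" "\<rho> j \<le> R" for j using R by (auto simp: \<rho>_def field_simps)
    have t_bounds: "0 \<le> t j" "t j \<le> \<sigma> * T" for j
      using \<sigma>T \<sigma> T by (auto simp: t_def intro!: mult_nonneg_nonneg mult_left_le)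
    have \<rho>_diff: "\<rho> j - \<rho> (Suc j) = R / (4 * 2 ^ j)" for j by (simp add: \<rho>_def field_simps)
    have t_diff: "t (Suc j) - t j = \<sigma> * T / (2 * 2 ^ j)" for j by (simp add: t_def field_simps)
    have V0: "0 \<le> V" by (simp add: V_def)
    have ball_measure: "measure lborel (ball x (\<rho> j)) \<le> V" for j
      unfolding V_def using \<rho>_bounds
      by (intro measure_mono_fmeasurable subset_ball) (auto intro!: fmeasurableI emeasure_bounded_finite)

    have bdd: "bounded U" using U by (simp add: bounded_C1_domain_def)
    have compact_cyl: "compact (closure U \<times> {0..T})"
      using bdd by (intro compact_Times) (auto simp: compact_closure)
    have cont: "continuous_on (closure U \<times> {0..T}) u"
      using sol by (auto simp: nonneg_solution_P_def solution_P_def intro: continuous_on_subset)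
    have ball_sub: "ball x R \<subseteq> U" using ball_U by (auto simp: in_compact_subset_def)
    have sub_cyl: "ball x r \<times> {s<..<T} \<subseteq> closure U \<times> {0..T}" if "r \<le> R" "0 \<le> s" for r s
      using that ball_sub closure_subset[of U] subset_ball[of r R x] by fastforce
    have Q_sub: "Q j \<subseteq> closure U \<times> {0..T}" for j
      unfolding Q_def using \<rho>_bounds t_bounds by (intro sub_cyl)
    have Qlim_sub: "?Qlim \<subseteq> Q j" for j
      unfolding Q_def using \<rho>_bounds[of j] t_bounds[of j] by (intro Sigma_mono subset_ball) auto
    have Q_sets: "Q j \<in> sets lborel" for j unfolding Q_def by (rule cylinder_in_sets)
    have int_Q: "set_integrable lborel (Q j) (\<lambda>z. \<bar>u z\<bar> powr p)" if "0 < p" for j p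
      by (rule continuous_on_compact_imp_set_integrable_powr[OF compact_cyl cont Q_sets Q_sub that])
    have Q_fm: "Q j \<in> fmeasurable lborel" for j
    proof -
      have "bounded (Q j)" using compact_imp_bounded[OF compact_cyl] Q_sub bounded_subset by blast
      then show ?thesis using Q_sets emeasure_bounded_finite by (auto intro!: fmeasurableI)
    qed
    have Q_measure: "measure lborel (Q j) \<le> 1 + V * T" for j
    proof -
      have "measure lborel (ball x (\<rho> j)) * (T - t j) \<le> V * T"
        using ball_measure[of j] t_bounds[of j] \<sigma>T V0 by (intro mult_mono) auto
      then show ?thesis
        unfolding Q_def using t_bounds[of j] \<sigma>T by (subst measure_cylinder) auto
    qed

    have E_ge: "2^11 \<le> E"
    proof -
      have f: "1 \<le> c10" "1 \<le> \<alpha>0 powr (6 - a)" "1 \<le> (1 + 1 / R)^2" "1 \<le> (1 + V * T)^3"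
        "1 \<le> (1 + 1 / (\<sigma> * T) + 1 / R powr (2 - a))^2"
        using c10_ge_1 \<alpha>0_1 a01 R T V0 \<sigma>T
        by (auto intro!: one_le_power ge_one_powr_ge_zero add_increasing2)
      have mult1: "1 \<le> y * z" if "1 \<le> y" "1 \<le> z" for y z :: real
        using mult_mono[of 1 y 1 z] that by simp
      have "1 \<le> c10 * \<alpha>0 powr (6 - a) * (1 + 1 / R)^2 * (1 + V * T)^3 *
          (1 + 1 / (\<sigma> * T) + 1 / R powr (2 - a))^2"
        by (intro mult1 f)
      then show ?thesis by (simp add: E_def mult.assoc)
    qed
    then have E1: "1 \<le> E" by simp

    have A_bound: "2 * (1 + V * T) * A_const c10 a (\<alpha> j) (measure lborel (ball x (\<rho> j)))
        (\<rho> (Suc j)) (\<rho> j) (t j) (t (Suc j)) T \<le> E powr (1 + d * real j)" (is "?A \<le> _") for j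
    proof -
      have "?A \<le> (2^11 * c10 * \<alpha> j powr (6 - a) * (1 + 1 / R)^2 * (1 + V * T)^3 *
          (1 + 1 / (\<sigma> * T) + 1 / R powr (2 - a))^2) * (2 ^ j)^4"
        using a01 c10_ge_1 R T \<sigma>T ball_measure \<rho>_bounds \<rho>_diff t_diff by (intro A_const_dyadic_bound) auto
      also have "\<dots> = E * D ^ j"
      proof -
        have "(\<kappa>s ^ j) powr (6 - a) = (\<kappa>s powr (6 - a)) ^ j"
          using \<kappa>1 by (simp add: powr_powr mult.commute flip: powr_realpow)
        moreover have "(2 ^ j) ^ 4 = (16 :: real) ^ j"
          by (simp add: power_mult[symmetric] mult.commute[of j] power_mult)
        ultimately show ?thesis
          using \<alpha>0(1) \<kappa>1 by (simp add: E_def D_def \<alpha>_def powr_mult power_mult_distrib)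
      qed
      also have "\<dots> \<le> E * (E powr d) ^ j"
        unfolding D_eq using E_ge d0 E1 by (intro mult_left_mono power_mono powr_mono2) auto
      also have "\<dots> = E powr (1 + d * real j)"
        using E1 by (simp add: powr_add powr_powr flip: powr_realpow)
      finally show ?thesis .
    qed

    have step: "Y (Suc j) \<le> E powr b j * max (rpow (Y j) (\<mu> j)) (rpow (Y j) (\<nu> j))" for j
    proof -
      define A where "A = A_const c10 a (\<alpha> j) (measure lborel (ball x (\<rho> j)))
        (\<rho> (Suc j)) (\<rho> j) (t j) (t (Suc j)) T"
      have A0: "0 \<le> A" using c10_ge_1 by (simp add: A_def A_const_def)
      \<comment> \<open>The gain at \<open>\<alpha>\<^sub>j\<close> is at least the gain at \<open>\<alpha>0\<close>, which alone is used.\<close>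
      have \<kappa>_mono: "\<kappa>s \<le> kappa n a \<delta> (\<alpha> j)"
        unfolding \<kappa>s kappa_def using \<alpha>_ge[of j] \<alpha>0(1) \<delta>(2) by (simp add: divide_left_mono)
      have \<alpha>_Suc: "\<alpha> (Suc j) = \<kappa>s * \<alpha> j" by (simp add: \<alpha>_def)
      have est: "Lp_norm (kappa n a \<delta> (\<alpha> j) * \<alpha> j) (Q (Suc j)) u
          \<le> A powr (1 / \<alpha> j) * (rpow (Y j) (\<alpha> j + \<delta> - 2) +
              rpow (Y j) ((\<alpha> j)\<^sup>2 / (\<alpha> j + \<delta> - a))) powr (1 / \<alpha> j)"
        unfolding A_def Y_def Q_def
      proof (rule c10_estimate[OF U sol])
        show "2 - \<delta> \<le> \<alpha> j" "alpha_star n a \<delta> < \<alpha> j" using \<alpha>_ge[of j] \<alpha>0 by auto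
        show "0 < \<rho> (Suc j)" using \<rho>_bounds[of "Suc j"] R by simp
        show "\<rho> (Suc j) < \<rho> j" using \<rho>_diff[of j] R by (smt (verit) divide_pos_pos zero_less_power)
        show "t j < t (Suc j)" using t_diff[of j] \<sigma>T by (smt (verit) divide_pos_pos zero_less_power)
        show "in_compact_subset (ball x (\<rho> j)) U"
          using ball_U subset_ball[OF \<rho>_bounds(2)] unfolding in_compact_subset_def by blast
        show "t (Suc j) < T" using t_bounds(2)[of "Suc j"] \<sigma>T(2) by (rule le_less_trans)
      qed (rule t_bounds)
      have "Y (Suc j) \<le> (2 * (1 + V * T) * A) powr (1 / \<alpha> j) *
          max (rpow (Y j) ((\<alpha> j + \<delta> - 2) / \<alpha> j)) (rpow (Y j) ((\<alpha> j)\<^sup>2 / (\<alpha> j + \<delta> - a) / \<alpha> j))"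
        unfolding Y_def[of "Suc j"]
      proof (rule Lp_norm_step[OF _ _ _ Q_fm int_Q Q_measure _ A0 _ _ _ est])
        show "\<alpha> j \<le> \<alpha> (Suc j)" "\<alpha> (Suc j) \<le> kappa n a \<delta> (\<alpha> j) * \<alpha> j"
          using \<kappa>1 \<kappa>_mono \<alpha>_pos[of j] by (auto simp: \<alpha>_Suc)
        show "0 < kappa n a \<delta> (\<alpha> j) * \<alpha> j" using \<kappa>1 \<kappa>_mono \<alpha>_pos[of j] by simp
        show "0 \<le> \<alpha> j + \<delta> - 2" using \<alpha>_ge[of j] \<alpha>0(2) by simp
        show "0 \<le> (\<alpha> j)\<^sup>2 / (\<alpha> j + \<delta> - a)" using den_pos[of j] by simp
      qed (use V0 T \<alpha>_pos in \<open>auto simp: Y_def Lp_norm_nonneg\<close>)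
      also have "(\<alpha> j + \<delta> - 2) / \<alpha> j = \<mu> j" by (simp add: \<mu>_def algebra_simps)
      also have "(\<alpha> j)\<^sup>2 / (\<alpha> j + \<delta> - a) / \<alpha> j = \<nu> j"
        using \<alpha>_pos[of j] by (simp add: \<nu>_def power2_eq_square)
      also have "(2 * (1 + V * T) * A) powr (1 / \<alpha> j) \<le> (E powr (1 + d * real j)) powr (1 / \<alpha> j)"
        using A_bound[of j] A0 V0 T \<alpha>_pos[of j] by (intro powr_mono2) (auto simp: A_def)
      also have "\<dots> = E powr b j" by (simp add: powr_powr b_def)
      finally show ?thesis by (simp add: mult_right_mono le_max_iff_disj rpow_nonneg)
    qed

    obtain C where C: "\<And>j. Y j \<le> C j"
      and C_lim: "C \<longlonglongrightarrow> E powr \<omega> * max (rpow (Y 0) (prodinf \<mu>)) (rpow (Y 0) (prodinf \<nu>))"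
      using max_power_iteration_limit[where Y = Y and E = E and b = b and \<mu> = \<mu> and \<nu> = \<nu>]
        step E1 b0 \<mu>01 \<nu>1 summable_b conv_\<mu> conv_\<nu> Lp_norm_nonneg unfolding Y_def \<omega>_def by metis

    have "Linf_norm ?Qlim u
        \<le> ereal (E powr \<omega> * max (rpow (Y 0) (prodinf \<mu>)) (rpow (Y 0) (prodinf \<nu>)))"
    proof (rule Linf_norm_le_of_Lp_norm_le[OF cylinder_in_sets _ \<alpha>_pos _ _ _ C_lim])
      have "continuous_on ?Qlim u" using cont Qlim_sub Q_sub by (meson continuous_on_subset)
      then show "u \<in> borel_measurable (restrict_space lborel ?Qlim)"
        using borel_measurable_continuous_on_restrict
        by (subst measurable_cong_sets[OF sets_restrict_space_cong[OF sets_lborel] refl])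
      have "filterlim (\<lambda>j. \<kappa>s ^ j) at_top sequentially"
        using \<kappa>1 by (intro filterlim_at_infinity_imp_filterlim_at_top
            filterlim_realpow_sequentially_gt1) auto
      then show "filterlim \<alpha> at_top sequentially"
        unfolding \<alpha>_def using \<alpha>0(1)
        by (rule filterlim_tendsto_pos_mult_at_top[OF tendsto_const, rotated])
      show "set_integrable lborel ?Qlim (\<lambda>z. \<bar>u z\<bar> powr \<alpha> j)" for j
        by (rule set_integrable_subset[OF int_Q[OF \<alpha>_pos] cylinder_in_sets Qlim_sub])
      show "Lp_norm (\<alpha> j) ?Qlim u \<le> C j" for j
        using Lp_norm_mono_set[OF Qlim_sub cylinder_in_sets \<alpha>_pos int_Q[OF \<alpha>_pos]] C[of j]
        unfolding Y_def by (rule order_trans)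
    qed
    moreover have "Y 0 = Lp_norm \<alpha>0 (ball x R \<times> {0<..<T}) u"
      by (simp add: Y_def Q_def \<alpha>_def \<rho>_def t_def)
    moreover have "C_hat c10 a \<alpha>0 \<omega> (measure lborel (ball x R)) R T \<sigma> = E powr \<omega>"
      by (simp add: C_hat_def E_def V_def)
    ultimately show ?thesis by (simp add: \<mu>_inf \<nu>_inf)
  qed
  with \<omega>_pos show ?thesis by blast
qed

end
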